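(* Let $G$ be a global amoeba. Then, for all sufficiently large $n$, $\mathrm{bal}(n,G)=\mathrm{ex}(n,\mathcal H_G)$.
   Context: Graphs are finite and simple; $e(G)$ is the number of edges of $G$. $\mathcal H_G$ is the class of all subgraphs $H\subset G$ that have exactly $\lfloor e(G)/2\rfloor$ edges and no isolated vertices. For a class $\mathcal H$ of graphs, $\mathrm{ex}(n,\mathcal H)$ is the maximum number of edges of a graph of order $n$ that contains no member of $\mathcal H$ as a subgraph. In a 2-edge-coloring of $K_n$, a copy of $G$ is balanced if it has $\lfloor e(G)/2\rfloor$ edges in one of the colors and $\lceil e(G)/2\rceil$ in the other. The balancing number $\mathrm{bal}(n,G)$ is the smallest integer $k\ge 0$ such that every 2-edge-coloring of $K_n$ with more than $k$ edges in each color contains a balanced copy of $G$. Global amoeba: $S_X$ is the symmetric group on a finite set $X$. A labeling of a graph $F$ with vertex set $V$ is a bijection $\lambda:V\to X$; write $v_x=\lambda^{-1}(x)$ and $L_F=\{ij : v_iv_j\in E(F)\}$. For $\sigma\in S_X$, $F_\sigma$ is the graph on $V$ with edge set $\{v_iv_j : \sigma(i)\sigma(j)\in L_F\}$. A feasible edge-replacement $rs\to kl$ is given by an edge $v_rv_s\in E(F)$ and a non-edge $v_kv_l\in E(\overline F)$ with $F-v_rv_s+v_kv_l\cong F$; the neutral replacement $\emptyset\to\emptyset$ is also feasible. Put $\mathrm{Fer}_F(rs\to kl)=\{\sigma\in S_X : F_\sigma=F-v_rv_s+v_kv_l\}$, $\mathrm{Fer}_F(\emptyset\to\emptyset)=\{\sigma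 : F_\sigma=F\}$, and let $\mathrm{Fer}(F)\le S_X$ be the group generated by the union of these sets over all feasible edge-replacements. A graph $G$ of order $N$ is a global amoeba if $\mathrm{Fer}(G\cup K_1)\cong S_{N+1}$, where $G\cup K_1$ is $G$ plus an isolated vertex. (Equivalently, for $n$ large enough, any copy of $G$ in $K_n$ can be transformed into any other copy of $G$ in $K_n$ by a chain of feasible edge-replacements.) *)

theory Defs
  imports Complex_Main "HOL-Library.Ramsey" "HOL-Algebra.Bij" "HOL-Algebra.Sym_Groups"
begin

section \<open>Finite simple graphs\<close>

record 'a graph =
  verts :: "'a set"
  edges :: "'a set set"

definition simple_graph :: "'a graph \<Rightarrow> bool" where
  "simple_graph G \<longleftrightarrow> finite (verts G) \<and> edges G \<subseteq> [verts G]\<^bsup>2\<^esup>"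

definition subgraph :: "'a graph \<Rightarrow> 'a graph \<Rightarrow> bool" where
  "subgraph H G \<longleftrightarrow> simple_graph H \<and> verts H \<subseteq> verts G \<and> edges H \<subseteq> edges G"

definition isomorphic :: "'a graph \<Rightarrow> 'b graph \<Rightarrow> bool" where
  "isomorphic G H \<longleftrightarrow>
     (\<exists>f. bij_betw f (verts G) (verts H) \<and> edges H = (\<lambda>e. f ` e) ` edges G)"

definition is_copy_in :: "'b graph \<Rightarrow> 'a graph \<Rightarrow> 'b graph \<Rightarrow> bool" where
  "is_copy_in C G F \<longleftrightarrow> subgraph C F \<and> isomorphic G C"

definition no_isolated :: "'a graph \<Rightarrow> bool" where
  "no_isolated G \<longleftrightarrow> (\<forall>v\<in>verts G. \<exists>e\<in>edges G. v \<in> e)"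

definition complete_graph :: "nat \<Rightarrow> nat graph" where
  "complete_graph n = \<lparr>verts = {..<n}, edges = [{..<n}]\<^bsup>2\<^esup>\<rparr>"


section \<open>The class of half-size subgraphs and the extremal number\<close>

definition half_subgraphs :: "'a graph \<Rightarrow> 'a graph set" where
  "half_subgraphs G =
     {H. subgraph H G \<and> card (edges H) = card (edges G) div 2 \<and> no_isolated H}"

text \<open>
  Graphs of order \<open>n\<close> are taken, up to isomorphism, on the vertex set \<open>{..<n}\<close>.
  On \<^typ>\<open>nat\<close>, the supremum of a nonempty finite set is its maximum, and the supremum of the
  empty set is \<open>0\<close>. The latter case arises only when the forbidden class contains an edgeless
  graph of order at most \<open>n\<close>; in particular \<^term>\<open>half_subgraphs G\<close> consists of just the graph
  without vertices if \<open>G\<close> has at most one edge, and the extremal number is then \<open>0\<close>.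
\<close>

definition ex_number :: "nat \<Rightarrow> 'a graph set \<Rightarrow> nat" where
  "ex_number n \<H> =
     Sup {card (edges F) | F. simple_graph F \<and> verts F = {..<n} \<and>
            (\<forall>H\<in>\<H>. \<not> (\<exists>C. is_copy_in C H F))}"


section \<open>Balanced copies and the balancing number\<close>

text \<open>
  A 2-edge-coloring of the complete graph is a function \<open>c :: nat set \<Rightarrow> bool\<close>, of which only the
  values on edges matter; the two colors are the two truth values.
\<close>

definition color_class :: "('a set \<Rightarrow> bool) \<Rightarrow> bool \<Rightarrow> 'a graph \<Rightarrow> 'a set set" where
  "color_class c b F = {e \<in> edges F. c e = b}"

definition balanced :: "('a set \<Rightarrow> bool) \<Rightarrow> 'a graph \<Rightarrow> bool" where
  "balanced c C \<longleftrightarrow>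
     (\<exists>b. card (color_class c b C) = card (edges C) div 2 \<and>
          card (color_class c (\<not> b) C) = (card (edges C) + 1) div 2)"

definition bal :: "nat \<Rightarrow> 'a graph \<Rightarrow> nat" where
  "bal n G =
     (LEAST k. \<forall>c. (\<forall>b. card (color_class c b (complete_graph n)) > k) \<longrightarrow>
                   (\<exists>C. is_copy_in C G (complete_graph n) \<and> balanced c C))"


section \<open>Feasible edge-replacements and global amoebas\<close>

text \<open>
  In this section \<open>l\<close> is a labeling of a graph \<open>F\<close>, that is, a bijection from \<^term>\<open>verts F\<close> to a
  finite set \<open>X\<close> of labels. \<open>lab_edge F l i j\<close> is the edge (or non-edge) with end labels \<open>i\<close>
  and \<open>j\<close>.
\<close>

definition lab_edge :: "'a graph \<Rightarrow> ('a \<Rightarrow> 'b) \<Rightarrow> 'b \<Rightarrow> 'b \<Rightarrow> 'a set" where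
  "lab_edge F l i j = {inv_into (verts F) l i, inv_into (verts F) l j}"

definition label_set :: "'a graph \<Rightarrow> ('a \<Rightarrow> 'b) \<Rightarrow> 'b set \<Rightarrow> 'b set set" where
  "label_set F l X = {{i, j} | i j. i \<in> X \<and> j \<in> X \<and> lab_edge F l i j \<in> edges F}"

definition perm_graph :: "'a graph \<Rightarrow> ('a \<Rightarrow> 'b) \<Rightarrow> 'b set \<Rightarrow> ('b \<Rightarrow> 'b) \<Rightarrow> 'a graph" where
  "perm_graph F l X \<sigma> =
     \<lparr>verts = verts F,
      edges = {lab_edge F l i j | i j. i \<in> X \<and> j \<in> X \<and> {\<sigma> i, \<sigma> j} \<in> label_set F l X}\<rparr>"

definition replace_edge ::
  "'a graph \<Rightarrow> ('a \<Rightarrow> 'b) \<Rightarrow> 'b \<Rightarrow> 'b \<Rightarrow> 'b \<Rightarrow> 'b \<Rightarrow> 'a graph" where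
  "replace_edge F l r s k m =
     \<lparr>verts = verts F, edges = insert (lab_edge F l k m) (edges F - {lab_edge F l r s})\<rparr>"

definition feasible ::
  "'a graph \<Rightarrow> ('a \<Rightarrow> 'b) \<Rightarrow> 'b set \<Rightarrow> 'b \<Rightarrow> 'b \<Rightarrow> 'b \<Rightarrow> 'b \<Rightarrow> bool" where
  "feasible F l X r s k m \<longleftrightarrow>
     {r, s, k, m} \<subseteq> X \<and>
     lab_edge F l r s \<in> edges F \<and> lab_edge F l k m \<in> [verts F]\<^bsup>2\<^esup> - edges F \<and>
     isomorphic (replace_edge F l r s k m) F"

definition Fer_repl ::
  "'a graph \<Rightarrow> ('a \<Rightarrow> 'b) \<Rightarrow> 'b set \<Rightarrow> 'b \<Rightarrow> 'b \<Rightarrow> 'b \<Rightarrow> 'b \<Rightarrow> ('b \<Rightarrow> 'b) set" where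
  "Fer_repl F l X r s k m =
     {\<sigma> \<in> carrier (BijGroup X). perm_graph F l X \<sigma> = replace_edge F l r s k m}"

definition Fer_neutral :: "'a graph \<Rightarrow> ('a \<Rightarrow> 'b) \<Rightarrow> 'b set \<Rightarrow> ('b \<Rightarrow> 'b) set" where
  "Fer_neutral F l X = {\<sigma> \<in> carrier (BijGroup X). perm_graph F l X \<sigma> = F}"

definition Fer :: "'a graph \<Rightarrow> ('a \<Rightarrow> 'b) \<Rightarrow> 'b set \<Rightarrow> ('b \<Rightarrow> 'b) monoid" where
  "Fer F l X =
     subgroup_generated (BijGroup X)
       (Fer_neutral F l X \<union>
        \<Union> {Fer_repl F l X r s k m | r s k m. feasible F l X r s k m})"

definition add_isolated :: "'a graph \<Rightarrow> 'a option graph" where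
  "add_isolated G =
     \<lparr>verts = insert None (Some ` verts G), edges = (\<lambda>e. Some ` e) ` edges G\<rparr>"

text \<open>
  Different labelings give isomorphic groups (conjugate by the relabeling), so it is immaterial
  which labeling is used; the labels are \<open>1, \<dots>, N + 1\<close>.
\<close>

definition global_amoeba :: "'a graph \<Rightarrow> bool" where
  "global_amoeba G \<longleftrightarrow>
     (let N = card (verts G); X = {1..N + 1} in
        \<exists>l :: 'a option \<Rightarrow> nat. bij_betw l (verts (add_isolated G)) X \<and>
          Fer (add_isolated G) l X \<cong> sym_group (N + 1))"

end

theory Submission
  imports Defs
begin

text \<open>
  Fix a colour and let \<open>r f\<close> be the number of edges of that colour in the copy of \<open>G\<close> given by an
  injection \<open>f\<close> of the vertices of \<open>G\<close> into those of \<open>K\<^sub>n\<close>. A graph on these vertices contains a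
  member of \<open>half_subgraphs G\<close> exactly if some copy of \<open>G\<close> in \<open>K\<^sub>n\<close> has at least half of its edges,
  rounded down, in that graph (\<open>half_subgraph_copy_iff\<close>), because \<open>n\<close> is large enough for an
  embedded half of \<open>G\<close> to be completed to an embedding of \<open>G\<close>.

  Upper bound. If both colour classes have more than \<open>ex_number n (half_subgraphs G)\<close> edges, then
  there is a copy of \<open>G\<close> with at least half of its edges, rounded down, in the first colour, and
  one with at least as many in the second. Let \<open>F\<close> be \<open>G\<close> with an added isolated vertex. A
  generator of the group of \<open>F\<close> changes an embedding of \<open>F\<close> so that its edge set loses at most one
  edge and gains at most one, and hence \<open>r\<close> changes by at most one
  (\<open>generator_changes_at_most_one_edge\<close>). The amoeba property says that these generators yield all
  permutations of the vertices of \<open>F\<close>. Since moving the isolated vertex to an unoccupied place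
  affects no edge, any two embeddings of \<open>F\<close> are linked by permutations and such moves
  (\<open>injections_connected\<close>). So \<open>r\<close> takes every value between any two of its values
  (\<open>global_amoeba_intermediate_value\<close>), and some copy is balanced.

  Lower bound. Colour an extremal graph \<open>F\<close> without a member of \<open>half_subgraphs G\<close> with one colour
  and its complement with the other. A balanced copy of \<open>G\<close> would have at least half of its edges,
  rounded down, in \<open>F\<close>, which is impossible. It remains to see that the complement of \<open>F\<close> has at
  least as many edges as \<open>F\<close>. If not, a random copy of \<open>G\<close> has on average at least half of its
  edges in \<open>F\<close>, so some copy does (\<open>embedding_above_average\<close>), again a contradiction.
\<close>

section \<open>Copies as images under injections\<close>

definition image_graph :: "('a \<Rightarrow> 'b) \<Rightarrow> 'a graph \<Rightarrow> 'b graph" where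
  "image_graph f G = \<lparr>verts = f ` verts G, edges = (`) f ` edges G\<rparr>"

lemma verts_image_graph [simp]: "verts (image_graph f G) = f ` verts G"
  and edges_image_graph [simp]: "edges (image_graph f G) = (`) f ` edges G"
  by (simp_all add: image_graph_def)

lemma edge_subset_verts: "simple_graph G \<Longrightarrow> e \<in> edges G \<Longrightarrow> e \<subseteq> verts G"
  by (auto simp: simple_graph_def nsets_def)

lemma finite_edges: "simple_graph G \<Longrightarrow> finite (edges G)"
  unfolding simple_graph_def by (meson finite_imp_finite_nsets finite_subset)

lemma image_graph_cong:
  assumes "simple_graph G" "\<And>v. v \<in> verts G \<Longrightarrow> f v = g v"
  shows "image_graph f G = image_graph g G"
proof -
  have "f ` e = g ` e" if "e \<in> edges G" for e
    using edge_subset_verts[OF assms(1) that] assms(2) by (intro image_cong) auto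
  then show ?thesis
    using assms(2) by (auto simp: image_graph_def intro!: image_cong)
qed

lemma inj_on_edges:
  assumes "simple_graph G" "inj_on f (verts G)"
  shows "inj_on ((`) f) (edges G)"
  using assms by (meson Pow_iff edge_subset_verts inj_on_image_Pow inj_on_subset subsetI)

lemma card_edges_image_graph:
  "simple_graph G \<Longrightarrow> inj_on f (verts G) \<Longrightarrow> card (edges (image_graph f G)) = card (edges G)"
  by (simp add: card_image inj_on_edges)

lemma image_edge_in_nsets:
  assumes "e \<in> [A]\<^bsup>2\<^esup>" "inj_on f A" "f ` A \<subseteq> B"
  shows "f ` e \<in> [B]\<^bsup>2\<^esup>"
  using assms by (auto simp: nsets_def card_image inj_on_subset)

lemma simple_graph_image_graph:
  assumes "simple_graph G" "inj_on f (verts G)"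
  shows "simple_graph (image_graph f G)"
  using assms by (auto simp: simple_graph_def intro!: image_edge_in_nsets)

lemma is_copy_in_iff:
  assumes "simple_graph G"
  shows "is_copy_in C G F \<longleftrightarrow>
    (\<exists>f. inj_on f (verts G) \<and> C = image_graph f G \<and> verts C \<subseteq> verts F \<and> edges C \<subseteq> edges F)"
proof
  assume "is_copy_in C G F"
  then obtain f where f: "bij_betw f (verts G) (verts C)" "edges C = (`) f ` edges G"
    and C: "verts C \<subseteq> verts F" "edges C \<subseteq> edges F"
    by (auto simp: is_copy_in_def isomorphic_def subgraph_def)
  have "C = image_graph f G"
    using f by (cases C) (simp add: image_graph_def bij_betw_def)
  then show "\<exists>f. inj_on f (verts G) \<and> C = image_graph f G \<and> verts C \<subseteq> verts F \<and> edges C \<subseteq> edges F"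
    using f C by (auto simp: bij_betw_def)
next
  assume "\<exists>f. inj_on f (verts G) \<and> C = image_graph f G \<and> verts C \<subseteq> verts F \<and> edges C \<subseteq> edges F"
  then show "is_copy_in C G F"
    using simple_graph_image_graph[OF assms]
    by (auto simp: is_copy_in_def isomorphic_def subgraph_def bij_betw_def)
qed

section \<open>Copies of half of the graph\<close>
lemma extend_injection:
  assumes "finite B" "finite W" "A \<subseteq> B" "card B \<le> card W" "inj_on f A" "f ` A \<subseteq> W"
  obtains g where "inj_on g B" "g ` B \<subseteq> W" "\<And>x. x \<in> A \<Longrightarrow> g x = f x"
proof -
  have "card (f ` A) = card A"
    using assms(5) by (rule card_image)
  then have "card (B - A) \<le> card (W - f ` A)"
    using assms by (simp add: card_Diff_subset finite_subset)
  then obtain h where h: "h ` (B - A) \<subseteq> W - f ` A" "inj_on h (B - A)"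
    using assms by (metis card_le_inj finite_Diff)
  let ?g = "\<lambda>x. if x \<in> A then f x else h x"
  have "inj_on ?g B"
    using h assms(3,5) by (auto simp: inj_on_def)
  moreover have "?g ` B \<subseteq> W"
    using h assms(6) by auto
  ultimately show thesis
    using that[of ?g] by simp
qed

text \<open>
  A copy of half of \<open>G\<close> extends to a copy of \<open>G\<close> since \<open>F\<close> has enough vertices. Conversely, the edges
  of a copy of \<open>G\<close> that lie in \<open>F\<close> can be thinned out to the required number, and the vertices are
  those covered by the chosen edges, so that none is isolated.
\<close>
lemma half_subgraph_copy_iff:
  assumes "simple_graph G" "simple_graph F" "card (verts G) \<le> card (verts F)"
  shows "(\<exists>H\<in>half_subgraphs G. \<exists>C. is_copy_in C H F) \<longleftrightarrow>
    (\<exists>f. inj_on f (verts G) \<and> f ` verts G \<subseteq> verts F \<and>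
         card (edges G) div 2 \<le> card (edges (image_graph f G) \<inter> edges F))"
    (is "?L \<longleftrightarrow> ?R")
proof
  assume ?L
  then obtain H C where H: "subgraph H G" "card (edges H) = card (edges G) div 2"
    and C: "is_copy_in C H F"
    by (auto simp: half_subgraphs_def)
  have sH: "simple_graph H" "verts H \<subseteq> verts G" "edges H \<subseteq> edges G"
    using H(1) by (auto simp: subgraph_def)
  obtain f where f: "inj_on f (verts H)" "f ` verts H \<subseteq> verts F" "(`) f ` edges H \<subseteq> edges F"
    using C sH(1) by (auto simp: is_copy_in_iff)
  obtain g where g: "inj_on g (verts G)" "g ` verts G \<subseteq> verts F" "\<And>x. x \<in> verts H \<Longrightarrow> g x = f x"
    using extend_injection[of "verts G" "verts F" "verts H" f] assms sH(2) f
    by (auto simp: simple_graph_def)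
  have gH: "image_graph g H = image_graph f H"
    by (rule image_graph_cong) (use sH(1) g(3) in auto)
  have "card (edges G) div 2 = card (edges (image_graph g H))"
    using H(2) gH sH(1) f(1) by (metis card_edges_image_graph)
  also have "\<dots> \<le> card (edges (image_graph g G) \<inter> edges F)"
  proof (rule card_mono)
    show "finite (edges (image_graph g G) \<inter> edges F)"
      using finite_edges[OF assms(2)] by simp
    show "edges (image_graph g H) \<subseteq> edges (image_graph g G) \<inter> edges F"
      using gH f(3) sH(3) by (metis edges_image_graph image_mono le_inf_iff)
  qed
  finally show ?R
    using g by blast
next
  assume ?R
  then obtain f where f: "inj_on f (verts G)" "f ` verts G \<subseteq> verts F"
    and le: "card (edges G) div 2 \<le> card (edges (image_graph f G) \<inter> edges F)"
    by blast
  let ?A = "{e \<in> edges G. f ` e \<in> edges F}"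
  have "edges (image_graph f G) \<inter> edges F = (`) f ` ?A"
    by auto
  moreover have "inj_on ((`) f) ?A"
    using inj_on_edges[OF assms(1) f(1)] by (rule inj_on_subset) auto
  ultimately have "card (edges G) div 2 \<le> card ?A"
    using le by (simp add: card_image)
  then obtain A where A: "A \<subseteq> ?A" "card A = card (edges G) div 2"
    by (meson obtain_subset_with_card_n)
  define H where "H = \<lparr>verts = \<Union>A, edges = A\<rparr>"
  have AG: "A \<subseteq> edges G"
    using A by auto
  have vH: "verts H \<subseteq> verts G"
    using AG edge_subset_verts[OF assms(1)] by (auto simp: H_def)
  have "A \<subseteq> [\<Union>A]\<^bsup>2\<^esup>"
    using AG assms(1) by (fastforce simp: simple_graph_def nsets_def)
  then have sH: "simple_graph H"
    using vH assms(1) by (auto simp: simple_graph_def H_def intro: finite_subset)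
  have "H \<in> half_subgraphs G"
    using sH vH AG A(2) by (auto simp: half_subgraphs_def subgraph_def no_isolated_def H_def)
  moreover have "is_copy_in (image_graph f H) H F"
    using is_copy_in_iff[OF sH] f vH A(1) inj_on_subset[OF f(1) vH]
    by (fastforce simp: H_def)
  ultimately show ?L
    by blast
qed

text \<open>
  Since the two colours share the edges of a copy, balance can be read off from the number of edges
  of either one.
\<close>
lemma balanced_copy_iff:
  assumes "simple_graph G"
  shows "(\<exists>C. is_copy_in C G (complete_graph n) \<and> balanced c C) \<longleftrightarrow>
    (\<exists>f. inj_on f (verts G) \<and> f ` verts G \<subseteq> {..<n} \<and>
         card (edges (image_graph f G) \<inter> {e. c e = b})
           \<in> {card (edges G) div 2, (card (edges G) + 1) div 2})"
    (is "_ \<longleftrightarrow> ?rhs")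
proof -
  have copy: "is_copy_in C G (complete_graph n) \<longleftrightarrow>
      (\<exists>f. inj_on f (verts G) \<and> C = image_graph f G \<and> f ` verts G \<subseteq> {..<n})" for C
  proof -
    have "edges (image_graph f G) \<subseteq> [{..<n}]\<^bsup>2\<^esup>"
      if "inj_on f (verts G)" "f ` verts G \<subseteq> {..<n}" for f
      using assms that by (auto simp: simple_graph_def intro!: image_edge_in_nsets)
    moreover have "verts (complete_graph n) = {..<n}" "edges (complete_graph n) = [{..<n}]\<^bsup>2\<^esup>"
      by (simp_all add: complete_graph_def)
    ultimately show ?thesis
      unfolding is_copy_in_iff[OF assms] by (metis verts_image_graph)
  qed
  have complementary: "(a = e div 2 \<and> a' = (e + 1) div 2) \<or> (a' = e div 2 \<and> a = (e + 1) div 2) \<longleftrightarrow>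
      a \<in> {e div 2, (e + 1) div 2}" if "e = a + a'" for a a' e :: nat
  proof -
    have "e div 2 + (e + 1) div 2 = e"
      by presburger
    then show ?thesis
      using that by auto
  qed
  have two_colors: "(\<exists>x. P x (\<not> x)) \<longleftrightarrow> P b (\<not> b) \<or> P (\<not> b) b" for P :: "bool \<Rightarrow> bool \<Rightarrow> bool"
    by (cases b) (auto simp: ex_bool_eq)
  have bal: "balanced c (image_graph f G) \<longleftrightarrow>
      card (edges (image_graph f G) \<inter> {e. c e = b})
        \<in> {card (edges G) div 2, (card (edges G) + 1) div 2}"
    if "inj_on f (verts G)" for f
  proof -
    let ?C = "image_graph f G"
    let ?k = "\<lambda>b. card (color_class c b ?C)"
    have fin: "finite (color_class c b ?C)" for b
      using finite_edges[OF assms] by (simp add: color_class_def)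
    have "edges ?C = color_class c b ?C \<union> color_class c (\<not> b) ?C"
      by (auto simp: color_class_def)
    then have "card (edges ?C) = ?k b + ?k (\<not> b)"
      using card_Un_disjoint[OF fin fin, of b "\<not> b"] by (auto simp: color_class_def)
    then have sum: "card (edges G) = ?k b + ?k (\<not> b)"
      using card_edges_image_graph[OF assms that] by (rule trans[OF sym, rotated])
    have "balanced c ?C \<longleftrightarrow>
        (?k b = card (edges G) div 2 \<and> ?k (\<not> b) = (card (edges G) + 1) div 2) \<or>
        (?k (\<not> b) = card (edges G) div 2 \<and> ?k b = (card (edges G) + 1) div 2)"
      unfolding balanced_def card_edges_image_graph[OF assms that]
      by (rule two_colors[where P = "\<lambda>x y. ?k x = card (edges G) div 2 \<and> ?k y = (card (edges G) + 1) div 2"])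
    also have "\<dots> \<longleftrightarrow> ?k b \<in> {card (edges G) div 2, (card (edges G) + 1) div 2}"
      by (rule complementary[OF sum])
    also have "?k b = card (edges ?C \<inter> {e. c e = b})"
      unfolding color_class_def by (rule arg_cong[of _ _ card]) auto
    finally show ?thesis .
  qed
  have "(\<exists>C. is_copy_in C G (complete_graph n) \<and> balanced c C) \<longleftrightarrow>
      (\<exists>f. inj_on f (verts G) \<and> f ` verts G \<subseteq> {..<n} \<and> balanced c (image_graph f G))"
    unfolding copy by blast
  also have "\<dots> \<longleftrightarrow> ?rhs"
    by (intro ex_cong1 conj_cong refl bal)
  finally show ?thesis .
qed

section \<open>Averaging over all copies\<close>

lemma image_Collect_mem: "f ` {x \<in> A. f x \<in> B} = f ` A \<inter> B"
  by auto
lemma permutation_taking_edge: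
  assumes "e \<in> [V]\<^bsup>2\<^esup>" "e' \<in> [V]\<^bsup>2\<^esup>"
  obtains p where "p permutes V" "p ` e = e'"
proof -
  obtain a b where e: "e = {a,b}" "a \<in> V" "b \<in> V" "a \<noteq> b"
    using assms(1) by (rule nsets2_E)
  obtain x y where e': "e' = {x,y}" "x \<in> V" "y \<in> V" "x \<noteq> y"
    using assms(2) by (rule nsets2_E)
  define q where "q = transpose a x"
  define p where "p = transpose (q b) y \<circ> q"
  have q: "q permutes V" "q a = x" "q b \<noteq> x"
    using e e' by (auto simp: q_def permutes_swap_id transpose_def)
  have "q b \<in> V"
    using q(1) e(3) by (simp add: permutes_in_image)
  then have "p permutes V"
    unfolding p_def using q(1) e'(3) by (intro permutes_compose permutes_swap_id)
  moreover have "p ` e = e'"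
    using q e' e(1) by (auto simp: p_def transpose_def)
  ultimately show thesis
    by (rule that)
qed

text \<open>
  By symmetry the numbers are equal: all edges are equally likely to be mapped into \<open>R\<close> by a random
  permutation.
\<close>
lemma card_permutations_edge_into:
  assumes "finite V" "e \<in> [V]\<^bsup>2\<^esup>" "e' \<in> [V]\<^bsup>2\<^esup>"
  shows "card {p. p permutes V \<and> p ` e \<in> R} \<le> card {p. p permutes V \<and> p ` e' \<in> R}"
proof -
  obtain q where q: "q permutes V" "q ` e' = e"
    using permutation_taking_edge[OF assms(3,2)] .
  have "inj_on (\<lambda>p. p \<circ> q) {p. p permutes V \<and> p ` e \<in> R}"
  proof (rule inj_onI)
    fix p p' :: "'a \<Rightarrow> 'a" assume "p \<circ> q = p' \<circ> q"
    then have "p \<circ> q \<circ> inv_into UNIV q = p' \<circ> q \<circ> inv_into UNIV q"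
      by simp
    then show "p = p'"
      by (simp add: comp_assoc permutes_inv_o(1)[OF q(1)] del: comp_apply)
  qed
  moreover have "(\<lambda>p. p \<circ> q) ` {p. p permutes V \<and> p ` e \<in> R} \<subseteq> {p. p permutes V \<and> p ` e' \<in> R}"
  proof safe
    fix p assume p: "p permutes V" "p ` e \<in> R"
    show "p \<circ> q permutes V"
      using q(1) p(1) by (rule permutes_compose)
    show "(p \<circ> q) ` e' \<in> R"
      using p(2) q(2) image_comp[of p q e'] by simp
  qed
  ultimately show ?thesis
    by (rule card_inj_on_le) (rule finite_subset[OF _ finite_permutations[OF assms(1)]], blast)
qed

text \<open>
  A random permutation maps each single edge into \<open>R\<close> with probability equal to the density of \<open>R\<close>,
  hence at least one half, and by linearity of expectation it maps on average at least half of the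
  edges of a fixed copy of \<open>G\<close> into \<open>R\<close>.
\<close>
lemma embedding_above_average:
  assumes G: "simple_graph G" and V: "finite V" "card (verts G) \<le> card V"
    and R: "R \<subseteq> [V]\<^bsup>2\<^esup>" "card ([V]\<^bsup>2\<^esup>) \<le> 2 * card R"
  obtains f where "inj_on f (verts G)" "f ` verts G \<subseteq> V"
    "card (edges G) \<le> 2 * card (edges (image_graph f G) \<inter> R)"
proof -
  obtain f where f: "f ` verts G \<subseteq> V" "inj_on f (verts G)"
    using G V by (metis card_le_inj simple_graph_def)
  define E where "E = edges (image_graph f G)"
  define P where "P = {p. p permutes V}"
  have E: "E \<subseteq> [V]\<^bsup>2\<^esup>" "finite E" "card E = card (edges G)"
    using G f finite_edges[OF G] card_edges_image_graph[OF G f(2)]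
    by (auto simp: E_def simple_graph_def intro!: image_edge_in_nsets)
  have P: "finite P" "P \<noteq> {}"
    using finite_permutations[OF V(1)] permutes_id[of V] unfolding P_def by (simp, metis empty_iff mem_Collect_eq)
  have fin: "finite ([V]\<^bsup>2\<^esup>)"
    using V(1) by (rule finite_imp_finite_nsets)
  have "\<exists>p\<in>P. card E \<le> 2 * card {e \<in> E. p ` e \<in> R}"
  proof (rule ccontr)
    assume "\<not> ?thesis"
    then have less: "2 * card {e \<in> E. p ` e \<in> R} < card E" if "p \<in> P" for p
      using that by (meson not_le)
    obtain p0 where "p0 \<in> P"
      using P(2) by blast
    then have "0 < card E"
      using less[of p0] by linarith
    then have "E \<noteq> {}"
      by auto
    then obtain e0 where e0: "e0 \<in> [V]\<^bsup>2\<^esup>"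
      using E(1) by auto
    define t where "t = card {p \<in> P. p ` e0 \<in> R}"
    have t: "card {p \<in> P. p ` e \<in> R} = t" if "e \<in> [V]\<^bsup>2\<^esup>" for e
      using card_permutations_edge_into[OF V(1) that e0] card_permutations_edge_into[OF V(1) e0 that]
      unfolding t_def P_def mem_Collect_eq by (rule le_antisym)
    \<comment> \<open>Counting pairs of a permutation and an edge; taking all edges for \<open>D\<close> determines \<open>t\<close>.\<close>
    have dc: "(\<Sum>p\<in>P. card {e \<in> D. p ` e \<in> R}) = card D * t" if "D \<subseteq> [V]\<^bsup>2\<^esup>" for D
    proof -
      have "(\<Sum>p\<in>P. card {e \<in> D. p ` e \<in> R}) = (\<Sum>e\<in>D. t)"
        by (rule sum_multicount_gen) (use t that P(1) finite_subset[OF that fin] in blast)+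
      then show ?thesis by simp
    qed
    have "card {e \<in> [V]\<^bsup>2\<^esup>. p ` e \<in> R} = card R" if "p \<in> P" for p
    proof -
      have p: "p permutes V" using that by (simp add: P_def)
      have "bij_betw ((`) p) ([V]\<^bsup>2\<^esup>) ([V]\<^bsup>2\<^esup>)"
        using bij_betw_nsets permutes_imp_bij[OF p] by blast
      then have "inj_on ((`) p) ([V]\<^bsup>2\<^esup>)" "(`) p ` [V]\<^bsup>2\<^esup> = [V]\<^bsup>2\<^esup>"
        by (simp_all add: bij_betw_def)
      then have "inj_on ((`) p) {e \<in> [V]\<^bsup>2\<^esup>. p ` e \<in> R}"
        "(`) p ` {e \<in> [V]\<^bsup>2\<^esup>. p ` e \<in> R} = R"
        using R(1) by (auto intro: inj_on_subset simp: image_Collect_mem)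
      then have "bij_betw ((`) p) {e \<in> [V]\<^bsup>2\<^esup>. p ` e \<in> R} R"
        by (rule bij_betw_imageI)
      then show ?thesis by (rule bij_betw_same_card)
    qed
    then have "card P * card R = card ([V]\<^bsup>2\<^esup>) * t"
      using dc[of "[V]\<^bsup>2\<^esup>"] by simp
    then have "2 * card R * card P = card ([V]\<^bsup>2\<^esup>) * (2 * t)"
      by (simp add: mult.commute del: card_nsets)
    then have "card ([V]\<^bsup>2\<^esup>) * card P \<le> card ([V]\<^bsup>2\<^esup>) * (2 * t)"
      using mult_le_mono1[OF R(2), of "card P"] by (simp only:)
    moreover have "card ([V]\<^bsup>2\<^esup>) > 0"
      using e0 fin card_gt_0_iff by blast
    ultimately have "card P \<le> 2 * t"
      by simp
    then have "card P * card E \<le> 2 * (card E * t)"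
      by (metis mult.commute mult.left_commute mult_le_mono1)
    also have "\<dots> = (\<Sum>p\<in>P. 2 * card {e \<in> E. p ` e \<in> R})"
      using dc[OF E(1)] by (simp flip: sum_distrib_left)
    also have "\<dots> < (\<Sum>p\<in>P. card E)"
      using P less by (intro sum_strict_mono) auto
    finally show False
      by simp
  qed
  then obtain p where p: "p permutes V" "card E \<le> 2 * card {e \<in> E. p ` e \<in> R}"
    by (auto simp: P_def)
  have "inj_on (p \<circ> f) (verts G)"
    using f(2) inj_on_subset[OF permutes_inj[OF p(1)]] by (auto intro: comp_inj_on)
  moreover have "(p \<circ> f) ` verts G \<subseteq> V"
    using f(1) permutes_image[OF p(1)] by (auto simp: image_comp[symmetric])
  moreover have "card (edges G) \<le> 2 * card (edges (image_graph (p \<circ> f) G) \<inter> R)"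
  proof -
    have "edges (image_graph (p \<circ> f) G) = (`) p ` E"
      by (simp add: E_def image_image comp_def)
    then have "edges (image_graph (p \<circ> f) G) \<inter> R = (`) p ` {e \<in> E. p ` e \<in> R}"
      by (simp only: image_Collect_mem)
    moreover have "inj_on ((`) p) {e \<in> E. p ` e \<in> R}"
      using permutes_inj[OF p(1)] by (intro inj_onI) (simp add: inj_image_eq_iff)
    ultimately show ?thesis
      using p(2) E(3) by (simp add: card_image)
  qed
  ultimately show thesis
    by (rule that)
qed

section \<open>The extremal number as a maximum\<close>
lemma bdd_above_ex_number_set:
  "bdd_above {card (edges F) | F. simple_graph F \<and> verts F = {..<n} \<and> Q F}"
proof (rule bdd_aboveI)
  fix k assume "k \<in> {card (edges F) | F. simple_graph F \<and> verts F = {..<n} \<and> Q F}"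
  then show "k \<le> card ([{..<n}]\<^bsup>2\<^esup>)"
    by (auto simp: simple_graph_def finite_imp_finite_nsets simp del: card_nsets intro!: card_mono)
qed

lemma copy_if_more_edges_than_ex_number:
  assumes "simple_graph F" "verts F = {..<n}" "ex_number n \<H> < card (edges F)"
  shows "\<exists>H\<in>\<H>. \<exists>C. is_copy_in C H F"
proof (rule ccontr)
  assume "\<not> ?thesis"
  then have "card (edges F) \<le> ex_number n \<H>"
    unfolding ex_number_def using assms(1,2)
    by (intro cSup_upper bdd_above_ex_number_set) auto
  then show False using assms(3) by simp
qed

text \<open>
  The lower bound on the extremal number excludes the case in which every graph contains a forbidden
  one and the supremum is taken over the empty set.
\<close>
lemma ex_number_attained:
  assumes "k < ex_number n \<H>"
  obtains F where "simple_graph F" "verts F = {..<n}" "\<not> (\<exists>H\<in>\<H>. \<exists>C. is_copy_in C H F)"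
    "card (edges F) = ex_number n \<H>"
proof -
  let ?S = "{card (edges F) | F. simple_graph F \<and> verts F = {..<n} \<and>
            (\<forall>H\<in>\<H>. \<not> (\<exists>C. is_copy_in C H F))}"
  have "?S \<noteq> {}"
    using assms unfolding ex_number_def by (metis Sup_nat_empty not_less_zero)
  moreover have "finite ?S"
    using bdd_above_ex_number_set by (rule bdd_above_nat[THEN iffD1])
  ultimately have "ex_number n \<H> \<in> ?S"
    unfolding ex_number_def by (metis (no_types, lifting) Max_in Sup_nat_def)
  then show thesis
    using that by auto
qed


section \<open>Properties invariant under the whole symmetric group\<close>
lemma card_Bij_le: "finite X \<Longrightarrow> finite (Bij X) \<and> card (Bij X) \<le> card {p. p permutes X}"
proof -
  assume X: "finite X"
  let ?ext = "\<lambda>\<sigma> x. if x \<in> X then \<sigma> x else x"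
  have "inj_on ?ext (Bij X)"
  proof (rule inj_onI)
    fix \<sigma> \<tau> assume "\<sigma> \<in> Bij X" "\<tau> \<in> Bij X" "?ext \<sigma> = ?ext \<tau>"
    then show "\<sigma> = \<tau>"
      by (intro extensionalityI[of \<sigma> X \<tau>]) (auto simp: Bij_def fun_eq_iff, metis)
  qed
  moreover have "?ext ` Bij X \<subseteq> {p. p permutes X}"
  proof safe
    fix \<sigma> assume "\<sigma> \<in> Bij X"
    then have "bij_betw (?ext \<sigma>) X X"
      by (auto simp: Bij_def cong: bij_betw_cong)
    then show "?ext \<sigma> permutes X"
      by (rule bij_imp_permutes) auto
  qed
  ultimately show ?thesis
    using finite_permutations[OF X] by (auto intro: card_inj_on_le inj_on_finite)
qed

text \<open>
  An abstract isomorphism suffices: a subgroup of a finite group with as many elements as the whole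
  group is the whole group.
\<close>
lemma carrier_eq_Bij_if_iso_sym_group:
  assumes "subgroup_generated (BijGroup {1..m}) S \<cong> sym_group m"
  shows "carrier (subgroup_generated (BijGroup {1..m}) S) = Bij {1..m}"
proof (rule card_seteq)
  show "finite (Bij {1..m})"
    using card_Bij_le by blast
  show "carrier (subgroup_generated (BijGroup {1..m}) S) \<subseteq> Bij {1..m}"
    using group.carrier_subgroup_generated_subset[OF group_BijGroup] by (fastforce simp: BijGroup_def)
  show "card (Bij {1..m}) \<le> card (carrier (subgroup_generated (BijGroup {1..m}) S))"
    using iso_same_card[OF assms] card_Bij_le[of "{1..m}"] by (simp add: sym_group_def)
qed

text \<open>
  The invariance is an equivalence rather than an implication so that it passes to inverses. \<open>P\<close> is
  required to depend only on the values on \<open>X\<close> because elements of \<^term>\<open>BijGroup X\<close> are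
  undefined outside \<open>X\<close>, so that a product with an inverse is the identity only on \<open>X\<close>.
\<close>
lemma invariant_under_generated_group:
  fixes P :: "('x \<Rightarrow> 'v) \<Rightarrow> bool"
  assumes cong: "\<And>g g'. (\<And>x. x \<in> X \<Longrightarrow> g x = g' x) \<Longrightarrow> P g = P g'"
    and gens: "\<And>g \<sigma>. \<lbrakk>\<sigma> \<in> S; \<sigma> \<in> Bij X; inj_on g X; g ` X \<subseteq> V\<rbrakk> \<Longrightarrow> P g = P (g \<circ> \<sigma>)"
    and \<sigma>: "\<sigma> \<in> carrier (subgroup_generated (BijGroup X) S)"
    and g: "inj_on g X" "g ` X \<subseteq> V"
  shows "P g = P (g \<circ> \<sigma>)"
proof -
  interpret group "BijGroup X" by (rule group_BijGroup)
  have comp: "inj_on (g \<circ> \<sigma>) X \<and> (g \<circ> \<sigma>) ` X \<subseteq> V"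
    if "\<sigma> \<in> Bij X" "inj_on g X" "g ` X \<subseteq> V" for g \<sigma>
    using that by (auto simp: Bij_def bij_betw_def image_comp[symmetric] intro: comp_inj_on)
  have "\<sigma> \<in> generate (BijGroup X) (Bij X \<inter> S)"
    using \<sigma> by (simp add: carrier_subgroup_generated BijGroup_def)
  then have "\<sigma> \<in> Bij X \<and> (\<forall>g. inj_on g X \<longrightarrow> g ` X \<subseteq> V \<longrightarrow> P g = P (g \<circ> \<sigma>))"
  proof induction
    case one
    have "P g = P (g \<circ> (\<lambda>x\<in>X. x))" for g
      by (rule cong) simp
    moreover have "\<one>\<^bsub>BijGroup X\<^esub> = (\<lambda>x\<in>X. x)"
      by (simp add: BijGroup_def)
    ultimately show ?case
      using id_Bij[of X] by (simp only:) blast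
  next
    case (incl \<sigma>)
    then show ?case using gens by blast
  next
    case (inv \<sigma>)
    let ?\<tau> = "\<lambda>x\<in>X. inv_into X \<sigma> x"
    have \<sigma>: "\<sigma> \<in> Bij X" "\<sigma> \<in> S" using inv by auto
    then have \<tau>: "?\<tau> \<in> Bij X" by (simp add: restrict_inv_into_Bij)
    have "P g = P (g \<circ> ?\<tau>)" if g: "inj_on g X" "g ` X \<subseteq> V" for g
    proof -
      have "P (g \<circ> ?\<tau>) = P (g \<circ> ?\<tau> \<circ> \<sigma>)"
        using gens \<sigma> comp[OF \<tau> g] by blast
      also have "\<dots> = P g"
        using \<sigma>(1) by (intro cong) (auto simp: Bij_def bij_betw_def)
      finally show ?thesis by simp
    qed
    then show ?case
      using \<tau> unfolding inv_BijGroup[OF \<sigma>(1)] by blast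
  next
    case (eng \<sigma> \<tau>)
    have "P g = P (g \<circ> (compose X \<sigma> \<tau>))" if g: "inj_on g X" "g ` X \<subseteq> V" for g
    proof -
      have "P g = P (g \<circ> \<sigma>)" using eng g by blast
      also have "\<dots> = P (g \<circ> \<sigma> \<circ> \<tau>)" using eng comp g by blast
      also have "\<dots> = P (g \<circ> (compose X \<sigma> \<tau>))" by (rule cong) (simp add: compose_def)
      finally show ?thesis .
    qed
    moreover have "\<sigma> \<otimes>\<^bsub>BijGroup X\<^esub> \<tau> = compose X \<sigma> \<tau>"
      using eng.IH by (simp add: BijGroup_def)
    ultimately show ?case
      using eng.IH compose_Bij[of \<sigma> X \<tau>] by (simp only:) blast
  qed
  then show ?thesis using g by blast
qed

text \<open>
  An injection can be turned into any other one by permuting \<open>X\<close> and moving the value at the single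
  point \<open>z\<close>. While the images of \<open>g\<close> and \<open>h\<close> differ, a transposition brings to \<open>z\<close> a value of \<open>g\<close> that
  \<open>h\<close> does not take, and this value is then replaced by one that \<open>h\<close> takes and \<open>g\<close> does not. Once
  the images agree, the two injections differ by a permutation.
\<close>
lemma injections_connected:
  fixes P :: "('x \<Rightarrow> 'v) \<Rightarrow> bool"
  assumes X: "finite X" "z \<in> X"
    and perm: "\<And>g \<sigma>. \<lbrakk>\<sigma> \<in> Bij X; inj_on g X; g ` X \<subseteq> V; P g\<rbrakk> \<Longrightarrow> P (g \<circ> \<sigma>)"
    and move: "\<And>g g'. \<lbrakk>\<And>x. x \<in> X - {z} \<Longrightarrow> g x = g' x; P g\<rbrakk> \<Longrightarrow> P g'"
    and h: "inj_on h X" "h ` X \<subseteq> V"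
    and g: "inj_on g X" "g ` X \<subseteq> V" "P g"
  shows "P h"
  using g
proof (induction "card (g ` X - h ` X)" arbitrary: g rule: less_induct)
  case less
  note g = less.prems
  have card_eq: "card (g ` X) = card (h ` X)"
    using g(1) h(1) by (simp add: card_image)
  show ?case
  proof (cases "g ` X \<subseteq> h ` X")
    case True
    then have eq: "g ` X = h ` X"
      using X(1) card_eq by (intro card_subset_eq) auto
    define \<sigma> where "\<sigma> = (\<lambda>x\<in>X. inv_into X g (h x))"
    have "bij_betw (inv_into X g \<circ> h) X X"
      using bij_betw_trans[of h X "h ` X" "inv_into X g" X] bij_betw_inv_into[of g X "h ` X"] h(1) g(1) eq
      by (simp add: bij_betw_def)
    then have "\<sigma> \<in> Bij X"
      by (auto simp: Bij_def \<sigma>_def cong: bij_betw_cong)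
    then have "P (g \<circ> \<sigma>)"
      using g perm by blast
    moreover have "(g \<circ> \<sigma>) x = h x" if "x \<in> X" for x
      using that eq by (auto simp: \<sigma>_def intro!: f_inv_into_f)
    ultimately show ?thesis
      using move by (metis DiffD1)
  next
    case False
    then obtain i where i: "i \<in> X" "g i \<notin> h ` X" by blast
    have "\<not> h ` X \<subseteq> g ` X"
      using False card_eq X(1) card_subset_eq[of "g ` X" "h ` X"] by auto
    then obtain w where w: "w \<in> h ` X" "w \<notin> g ` X" by blast
    define \<sigma> where "\<sigma> = restrict (transpose i z) X"
    define g' where "g' = (g \<circ> \<sigma>)(z := w)"
    have im: "transpose i z ` X = X"
      using i(1) X(2) by simp
    then have "\<sigma> \<in> Bij X"
      by (simp add: Bij_def \<sigma>_def bij_betw_def inj_on_restrict_eq)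
    then have "P (g \<circ> \<sigma>)"
      using g perm by blast
    then have "P g'"
      by (rule move[rotated]) (simp add: g'_def)
    have g'x: "g' x = (if x = z then w else if x = i then g z else g x)" if "x \<in> X" for x
      using that by (auto simp: g'_def \<sigma>_def transpose_def)
    have "inj_on g' X"
      using g(1) w(2) i(1) X(2) by (auto simp: inj_on_def g'x)
    moreover have im': "g' ` X \<subseteq> insert w (g ` X - {g i})"
      using g(1) i(1) X(2) by (auto simp: g'x inj_on_def)
    moreover have "g' ` X \<subseteq> V"
      using im' w(1) h(2) g(2) by blast
    moreover have "card (g' ` X - h ` X) < card (g ` X - h ` X)"
    proof (rule psubset_card_mono)
      show "g' ` X - h ` X \<subset> g ` X - h ` X"
      proof (rule psubsetI)
        show "g' ` X - h ` X \<subseteq> g ` X - h ` X"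
          using im' w(1) by auto
        have "g i \<notin> g' ` X"
          using im' i(2) w(1) by auto
        then show "g' ` X - h ` X \<noteq> g ` X - h ` X"
          using i by auto
      qed
    qed (use X(1) in simp)
    ultimately show ?thesis
      using less.hyps \<open>P g'\<close> by blast
  qed
qed

section \<open>Feasible edge-replacements acting on copies\<close>

text \<open>
  Permuting the labels of \<open>F\<close> by \<open>\<sigma>\<close> and permuting the positions accordingly cancel out. So the same
  copy arises from \<open>F\<close> and from the permuted graph, which for a generator differs from \<open>F\<close> in at
  most one edge.
\<close>
lemma image_perm_graph:
  assumes F: "simple_graph F" and l: "bij_betw l (verts F) X" and \<sigma>: "\<sigma> \<in> Bij X"
  shows "image_graph (g \<circ> \<sigma> \<circ> l) (perm_graph F l X \<sigma>) = image_graph (g \<circ> l) F"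
proof -
  let ?v = "inv_into (verts F) l"
  have lv: "l (?v x) = x" if "x \<in> X" for x
    using that l by (simp add: bij_betw_inv_into_right)
  have lab: "h ` l ` lab_edge F l i j = {h i, h j}" if "i \<in> X" "j \<in> X" for h :: "_ \<Rightarrow> 'c" and i j
    using that by (simp add: lab_edge_def lv)
  have \<sigma>X: "\<sigma> ` X = X"
    using \<sigma> by (simp add: Bij_def bij_betw_def)
  have "(`) (g \<circ> \<sigma> \<circ> l) ` edges (perm_graph F l X \<sigma>) = (`) (g \<circ> l) ` edges F"
  proof (intro equalityI subsetI)
    fix e assume "e \<in> (`) (g \<circ> \<sigma> \<circ> l) ` edges (perm_graph F l X \<sigma>)"
    then obtain i j where ij: "i \<in> X" "j \<in> X" "{\<sigma> i, \<sigma> j} \<in> label_set F l X"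
      and e: "e = (g \<circ> \<sigma>) ` l ` lab_edge F l i j"
      by (auto simp: perm_graph_def image_comp comp_assoc)
    then obtain a b where ab: "a \<in> X" "b \<in> X" "lab_edge F l a b \<in> edges F" "{\<sigma> i, \<sigma> j} = {a, b}"
      by (auto simp: label_set_def)
    have "e = g ` {\<sigma> i, \<sigma> j}"
      using lab[OF ij(1,2), of "g \<circ> \<sigma>"] e by simp
    also have "\<dots> = g ` l ` lab_edge F l a b"
      using ab by (simp add: lab)
    finally show "e \<in> (`) (g \<circ> l) ` edges F"
      using ab(3) by (auto simp: image_comp)
  next
    fix e assume "e \<in> (`) (g \<circ> l) ` edges F"
    then obtain d where d: "d \<in> edges F" "e = g ` l ` d"
      by (auto simp: image_comp)
    obtain u w where uw: "d = {u, w}" "u \<in> verts F" "w \<in> verts F"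
      using F d(1) by (auto simp: simple_graph_def elim!: nsets2_E[OF subsetD])
    have "l u \<in> X" "l w \<in> X"
      using l uw by (auto simp: bij_betw_def)
    then obtain i j where ij: "i \<in> X" "j \<in> X" "\<sigma> i = l u" "\<sigma> j = l w"
      using \<sigma>X by (metis imageE)
    have lab_d: "lab_edge F l (l u) (l w) = d"
      using l uw by (simp add: lab_edge_def bij_betw_inv_into_left)
    then have "{\<sigma> i, \<sigma> j} \<in> label_set F l X"
      using ij d(1) \<open>l u \<in> X\<close> \<open>l w \<in> X\<close> by (auto simp: label_set_def)
    then have "lab_edge F l i j \<in> edges (perm_graph F l X \<sigma>)"
      using ij(1,2) unfolding perm_graph_def graph.select_convs by blast
    moreover have "e = (g \<circ> \<sigma>) ` l ` lab_edge F l i j"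
      using lab[OF ij(1,2), of "g \<circ> \<sigma>"] ij d(2) uw(1) by simp
    ultimately show "e \<in> (`) (g \<circ> \<sigma> \<circ> l) ` edges (perm_graph F l X \<sigma>)"
      by (auto simp: image_comp comp_assoc)
  qed
  moreover have "(g \<circ> \<sigma> \<circ> l) ` verts F = (g \<circ> l) ` verts F"
    using l \<sigma>X by (simp add: bij_betw_def image_comp[symmetric] del: comp_apply)
  ultimately show ?thesis
    by (simp add: image_graph_def perm_graph_def)
qed

lemma card_replaced_image_Int:
  assumes "finite E" "a \<in> E"
  shows "card (f ` insert b (E - {a}) \<inter> R) \<le> card (f ` E \<inter> R) + 1"
    and "card (f ` E \<inter> R) \<le> card (f ` insert b (E - {a}) \<inter> R) + 1"
proof -
  have le: "card A \<le> card B + 1" if "finite B" "A \<subseteq> insert x B" for A B :: "'b set" and x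
  proof -
    have "card A \<le> card (insert x B)"
      using that by (intro card_mono) auto
    also have "\<dots> \<le> card B + 1"
      using that(1) by (simp add: card_insert_if)
    finally show ?thesis .
  qed
  show "card (f ` insert b (E - {a}) \<inter> R) \<le> card (f ` E \<inter> R) + 1"
    by (rule le[of _ _ "f b"]) (use assms in auto)
  show "card (f ` E \<inter> R) \<le> card (f ` insert b (E - {a}) \<inter> R) + 1"
    by (rule le[of _ _ "f a"]) (use assms in auto)
qed

definition Fer_generators :: "'a graph \<Rightarrow> ('a \<Rightarrow> 'b) \<Rightarrow> 'b set \<Rightarrow> ('b \<Rightarrow> 'b) set" where
  "Fer_generators F l X = Fer_neutral F l X \<union>
     \<Union> {Fer_repl F l X r s k m | r s k m. feasible F l X r s k m}"

text \<open>
  With \<open>h = g \<circ> \<sigma>\<close>, the copy given by \<open>g\<close> is the image under \<open>h\<close> of the permuted graph, and the copy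
  given by \<open>h\<close> is the image under \<open>h\<close> of \<open>F\<close>. These two graphs are equal
  or differ by the replacement of one edge.
\<close>
lemma generator_changes_at_most_one_edge:
  assumes F: "simple_graph F" and l: "bij_betw l (verts F) X" and \<sigma>: "\<sigma> \<in> Fer_generators F l X"
  shows "card (edges (image_graph (g \<circ> l) F) \<inter> R)
      \<le> card (edges (image_graph (g \<circ> \<sigma> \<circ> l) F) \<inter> R) + 1"
    and "card (edges (image_graph (g \<circ> \<sigma> \<circ> l) F) \<inter> R)
      \<le> card (edges (image_graph (g \<circ> l) F) \<inter> R) + 1"
proof -
  have "\<sigma> \<in> Bij X"
    using \<sigma> by (auto simp: Fer_generators_def Fer_neutral_def Fer_repl_def BijGroup_def)
  then have img: "image_graph (g \<circ> l) F = image_graph (g \<circ> \<sigma> \<circ> l) (perm_graph F l X \<sigma>)"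
    using image_perm_graph[OF F l] by metis
  consider "perm_graph F l X \<sigma> = F"
    | r s k m where "lab_edge F l r s \<in> edges F" "perm_graph F l X \<sigma> = replace_edge F l r s k m"
    using \<sigma> by (auto simp: Fer_generators_def Fer_neutral_def Fer_repl_def feasible_def)
  then have "card (edges (image_graph (g \<circ> l) F) \<inter> R)
      \<le> card (edges (image_graph (g \<circ> \<sigma> \<circ> l) F) \<inter> R) + 1 \<and>
    card (edges (image_graph (g \<circ> \<sigma> \<circ> l) F) \<inter> R)
      \<le> card (edges (image_graph (g \<circ> l) F) \<inter> R) + 1"
  proof cases
    case 1
    then show ?thesis unfolding img by simp
  next
    case (2 r s k m)
    then show ?thesis
      unfolding img edges_image_graph replace_edge_def graph.select_convs
      using card_replaced_image_Int[OF finite_edges[OF F]] by (simp only: graph.select_convs) blast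
  qed
  then show "card (edges (image_graph (g \<circ> l) F) \<inter> R)
      \<le> card (edges (image_graph (g \<circ> \<sigma> \<circ> l) F) \<inter> R) + 1"
    and "card (edges (image_graph (g \<circ> \<sigma> \<circ> l) F) \<inter> R)
      \<le> card (edges (image_graph (g \<circ> l) F) \<inter> R) + 1"
    by simp_all
qed

text \<open>
  If no copy had exactly \<open>k\<close> edges in \<open>R\<close>, then having more than \<open>k\<close> would be invariant under the
  generators, which cannot jump over \<open>k\<close>. It would then be invariant under all permutations and under
  moves of the isolated vertex, and hence the same for all copies. The room for the isolated
  vertex is the reason why \<open>V\<close> must have more elements than \<open>G\<close> has vertices.
\<close>
lemma global_amoeba_intermediate_value:
  assumes G: "simple_graph G" and amoeba: "global_amoeba G"
    and V: "finite V" "card (verts G) < card V"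
    and f: "inj_on f (verts G)" "f ` verts G \<subseteq> V" "k \<le> card (edges (image_graph f G) \<inter> R)"
    and h: "inj_on h (verts G)" "h ` verts G \<subseteq> V" "card (edges (image_graph h G) \<inter> R) \<le> k"
  obtains j where "inj_on j (verts G)" "j ` verts G \<subseteq> V" "card (edges (image_graph j G) \<inter> R) = k"
proof (rule ccontr)
  assume not_thesis: "\<not> thesis"
  note found = that
  define F where "F = add_isolated G"
  define X where "X = {1..card (verts G) + 1}"
  obtain l :: "'a option \<Rightarrow> nat" where l: "bij_betw l (verts F) X"
    and iso: "Fer F l X \<cong> sym_group (card (verts G) + 1)"
    using amoeba by (auto simp: global_amoeba_def Let_def F_def X_def)
  have Fer: "carrier (subgroup_generated (BijGroup X) (Fer_generators F l X)) = Bij X"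
    using iso carrier_eq_Bij_if_iso_sym_group unfolding Fer_def Fer_generators_def X_def by blast
  have vF: "verts F = insert None (Some ` verts G)"
    by (simp add: F_def add_isolated_def)
  have F: "simple_graph F"
    using G unfolding simple_graph_def F_def add_isolated_def
    by (auto intro!: image_edge_in_nsets)
  have imgF: "edges (image_graph \<phi> F) = edges (image_graph (\<phi> \<circ> Some) G)" for \<phi> :: "'a option \<Rightarrow> 'b"
    by (simp add: F_def add_isolated_def image_comp comp_def)
  define r where "r g = card (edges (image_graph (g \<circ> l) F) \<inter> R)" for g :: "nat \<Rightarrow> 'b"
  have r_ne: "r g \<noteq> k" if "inj_on g X" "g ` X \<subseteq> V" for g
  proof
    assume "r g = k"
    moreover have "inj_on (g \<circ> l) (verts F)" "(g \<circ> l) ` verts F \<subseteq> V"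
      using that l by (auto simp: bij_betw_def intro: comp_inj_on)
    then have "inj_on (g \<circ> l \<circ> Some) (verts G)" "(g \<circ> l \<circ> Some) ` verts G \<subseteq> V"
      by (auto simp: vF inj_on_def)
    ultimately show False
      using not_thesis found[of "g \<circ> l \<circ> Some"] unfolding r_def imgF by blast
  qed
  \<comment> \<open>The label of the isolated vertex lies on no edge, so its position is irrelevant.\<close>
  have r_cong: "r g = r g'" if "\<And>x. x \<in> X - {l None} \<Longrightarrow> g x = g' x" for g g'
  proof -
    have "l (Some v) \<in> X - {l None}" if "v \<in> verts G" for v
      using l that by (auto simp: bij_betw_def vF inj_on_def)
    then have "image_graph (g \<circ> l \<circ> Some) G = image_graph (g' \<circ> l \<circ> Some) G"
      using that by (intro image_graph_cong[OF G]) simp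
    then show ?thesis
      by (simp only: r_def imgF)
  qed
  have lift: "\<exists>g. inj_on g X \<and> g ` X \<subseteq> V \<and> r g = card (edges (image_graph p G) \<inter> R)"
    if p: "inj_on p (verts G)" "p ` verts G \<subseteq> V" for p
  proof -
    have "card (p ` verts G) < card V"
      using V(2) p(1) by (simp add: card_image)
    then obtain w where w: "w \<in> V" "w \<notin> p ` verts G"
      using V(1) by (metis card_mono finite_subset leD p(2) subsetI)
    let ?\<phi> = "case_option w p"
    let ?g = "?\<phi> \<circ> inv_into (verts F) l"
    have \<phi>: "inj_on ?\<phi> (verts F)" "?\<phi> ` verts F \<subseteq> V"
      using p w by (auto simp: vF inj_on_def)
    have "inj_on ?g X" "?g ` X \<subseteq> V"
      using bij_betw_inv_into[OF l] \<phi> by (auto simp: bij_betw_def intro: comp_inj_on)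
    moreover have "image_graph (?g \<circ> l) F = image_graph ?\<phi> F"
      using l by (intro image_graph_cong[OF F]) (simp add: bij_betw_inv_into_left)
    then have "r ?g = card (edges (image_graph (?\<phi> \<circ> Some) G) \<inter> R)"
      by (simp only: r_def imgF)
    moreover have "?\<phi> \<circ> Some = p"
      by auto
    ultimately show ?thesis
      by metis
  qed
  obtain f' where f': "inj_on f' X" "f' ` X \<subseteq> V" "k \<le> r f'"
    using lift[OF f(1,2)] f(3) by metis
  obtain h' where h': "inj_on h' X" "h' ` X \<subseteq> V" "r h' \<le> k"
    using lift[OF h(1,2)] h(3) by metis
  have comp: "inj_on (g \<circ> \<sigma>) X" "(g \<circ> \<sigma>) ` X \<subseteq> V"
    if "\<sigma> \<in> Bij X" "inj_on g X" "g ` X \<subseteq> V" for g \<sigma>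
    using that by (auto simp: Bij_def bij_betw_def intro: comp_inj_on)
  have gen: "(k < r g) = (k < r (g \<circ> \<sigma>))"
    if "\<sigma> \<in> Fer_generators F l X" "\<sigma> \<in> Bij X" "inj_on g X" "g ` X \<subseteq> V" for g \<sigma>
    using generator_changes_at_most_one_edge[OF F l that(1), of g R]
      r_ne[OF that(3,4)] r_ne[OF comp[OF that(2-4)]]
    unfolding r_def by linarith
  have perm: "k < r (g \<circ> \<sigma>)"
    if "\<sigma> \<in> Bij X" "inj_on g X" "g ` X \<subseteq> V" "k < r g" for g \<sigma>
  proof -
    have "(k < r g) = (k < r (g \<circ> \<sigma>))"
    proof (rule invariant_under_generated_group[where S = "Fer_generators F l X" and V = V and X = X])
      show "(k < r g) = (k < r g')" if "\<And>x. x \<in> X \<Longrightarrow> g x = g' x" for g g'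
        using r_cong[of g g'] that by simp
      show "(k < r g) = (k < r (g \<circ> \<sigma>))"
        if "\<sigma> \<in> Fer_generators F l X" "\<sigma> \<in> Bij X" "inj_on g X" "g ` X \<subseteq> V" for g \<sigma>
        using that by (rule gen)
      show "\<sigma> \<in> carrier (subgroup_generated (BijGroup X) (Fer_generators F l X))"
        using that(1) Fer by simp
    qed (rule that(2,3))+
    then show ?thesis
      using that(4) by simp
  qed
  have "k < r h'"
  proof (rule injections_connected[where X = X and z = "l None" and V = V and g = f' and P = "\<lambda>g. k < r g"])
    show "finite X" "l None \<in> X"
      using l by (auto simp: X_def vF bij_betw_def)
    show "k < r f'"
      using f' r_ne[of f'] by simp
    show "k < r g'" if "\<And>x. x \<in> X - {l None} \<Longrightarrow> g x = g' x" "k < r g" for g g'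
      using r_cong[of g g'] that by simp
  qed (use perm f' h' in auto)
  then show False
    using h'(3) by simp
qed

section \<open>The balancing number of a global amoeba\<close>
theorem theorem11:
  fixes G :: "'a graph"
  assumes "simple_graph G"
    and "global_amoeba G"
  shows "\<forall>\<^sub>F n in sequentially. bal n G = ex_number n (half_subgraphs G)"
proof (rule eventually_sequentiallyI)
  fix n assume n: "card (verts G) + 1 \<le> n"
  let ?e = "card (edges G)" and ?ex = "ex_number n (half_subgraphs G)"
  let ?K = "[{..<n}]\<^bsup>2\<^esup>"
  let ?balanced_copy = "\<lambda>c. \<exists>C. is_copy_in C G (complete_graph n) \<and> balanced c C"
  have finK: "finite ?K"
    by (simp add: finite_imp_finite_nsets)
  have class_simple: "simple_graph \<lparr>verts = {..<n}, edges = color_class c b (complete_graph n)\<rparr>" for c b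
    by (auto simp: simple_graph_def color_class_def complete_graph_def)
  have half_iff: "(\<exists>H\<in>half_subgraphs G. \<exists>C. is_copy_in C H F) \<longleftrightarrow>
      (\<exists>f. inj_on f (verts G) \<and> f ` verts G \<subseteq> {..<n} \<and>
        ?e div 2 \<le> card (edges (image_graph f G) \<inter> edges F))"
    if "simple_graph F" "verts F = {..<n}" for F :: "nat graph"
    using half_subgraph_copy_iff[OF assms(1) that(1)] that(2) n by simp
  have upper: "?balanced_copy c"
    if many: "\<forall>b. card (color_class c b (complete_graph n)) > ?ex" for c
  proof -
    let ?r = "\<lambda>f b. card (edges (image_graph f G) \<inter> {e. c e = b})"
    have half: "\<exists>f. inj_on f (verts G) \<and> f ` verts G \<subseteq> {..<n} \<and> ?e div 2 \<le> ?r f b" for b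
    proof -
      let ?F = "\<lparr>verts = {..<n}, edges = color_class c b (complete_graph n)\<rparr>"
      have "\<exists>H\<in>half_subgraphs G. \<exists>C. is_copy_in C H ?F"
        using copy_if_more_edges_than_ex_number[of ?F n "half_subgraphs G"] class_simple many by simp
      then obtain f where f: "inj_on f (verts G)" "f ` verts G \<subseteq> {..<n}"
        "?e div 2 \<le> card (edges (image_graph f G) \<inter> edges ?F)"
        using half_iff[OF class_simple] by auto
      note f(3)
      also have "card (edges (image_graph f G) \<inter> edges ?F) \<le> ?r f b"
        using finite_edges[OF assms(1)] by (intro card_mono) (auto simp: color_class_def)
      finally show ?thesis using f(1,2) by blast
    qed
    have sum: "?r f True + ?r f False = ?e" if "inj_on f (verts G)" for f
    proof -
      have "edges (image_graph f G) - {e. c e = True} = edges (image_graph f G) \<inter> {e. c e = False}"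
        by auto
      then have "card (edges (image_graph f G)) = ?r f True + ?r f False"
        using card_Int_Diff[of "edges (image_graph f G)" "{e. c e = True}"] finite_edges[OF assms(1)]
        by simp
      then show ?thesis
        using card_edges_image_graph[OF assms(1) that] by simp
    qed
    obtain f where f: "inj_on f (verts G)" "f ` verts G \<subseteq> {..<n}" "?e div 2 \<le> ?r f True"
      using half by blast
    obtain h where h: "inj_on h (verts G)" "h ` verts G \<subseteq> {..<n}" "?e div 2 \<le> ?r h False"
      using half by blast
    have "?r h True \<le> (?e + 1) div 2"
      using sum[OF h(1)] h(3) by linarith
    have "\<exists>j. inj_on j (verts G) \<and> j ` verts G \<subseteq> {..<n} \<and> ?r j True \<in> {?e div 2, (?e + 1) div 2}"
    \<comment> \<open>Either \<open>f\<close> is balanced itself, or the larger balanced value lies between those of \<open>h\<close> and \<open>f\<close>.\<close>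
    proof (cases "?r f True \<le> (?e + 1) div 2")
      case True
      then have "?r f True = ?e div 2 \<or> ?r f True = (?e + 1) div 2"
        using f(3) by presburger
      then show ?thesis using f by blast
    next
      case False
      then show ?thesis
        using global_amoeba_intermediate_value[OF assms, of "{..<n}" f "(?e + 1) div 2" "{e. c e = True}" h]
          f h n \<open>?r h True \<le> (?e + 1) div 2\<close>
        by (metis card_lessThan finite_lessThan insertCI nat_le_linear Suc_eq_plus1 Suc_le_eq)
    qed
    then show ?thesis
      by (rule balanced_copy_iff[OF assms(1), THEN iffD2])
  qed
  show "bal n G = ?ex"
    unfolding bal_def
  proof (rule Least_equality)
    show "\<forall>c. (\<forall>b. card (color_class c b (complete_graph n)) > ?ex) \<longrightarrow> ?balanced_copy c"
      using upper by blast
  next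
    fix k
    assume k: "\<forall>c. (\<forall>b. card (color_class c b (complete_graph n)) > k) \<longrightarrow> ?balanced_copy c"
    show "?ex \<le> k"
    proof (rule ccontr)
      assume "\<not> ?ex \<le> k"
      then obtain F where F: "simple_graph F" "verts F = {..<n}" "card (edges F) = ?ex"
        and free: "\<not> (\<exists>H\<in>half_subgraphs G. \<exists>C. is_copy_in C H F)" and "k < ?ex"
        using ex_number_attained by (metis not_le)
      have FK: "edges F \<subseteq> ?K"
        using F(1,2) by (auto simp: simple_graph_def)
      have sparse: "2 * card (edges F) < card ?K"
      proof (rule ccontr)
        assume "\<not> ?thesis"
        then obtain f where f: "inj_on f (verts G)" "f ` verts G \<subseteq> {..<n}"
          "?e \<le> 2 * card (edges (image_graph f G) \<inter> edges F)"
          using embedding_above_average[OF assms(1), of "{..<n}" "edges F"] FK n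
          by (metis card_lessThan finite_lessThan Suc_eq_plus1 Suc_leD not_le)
        then have "?e div 2 \<le> card (edges (image_graph f G) \<inter> edges F)"
          by linarith
        then show False
          using free f(1,2) half_iff[OF F(1,2)] by blast
      qed
      define c where "c e \<longleftrightarrow> e \<in> edges F" for e
      have "color_class c True (complete_graph n) = edges F"
        "color_class c False (complete_graph n) = ?K - edges F"
        using FK by (auto simp: color_class_def complete_graph_def c_def)
      then have "k < card (color_class c b (complete_graph n))" for b
        using F(3) \<open>k < ?ex\<close> sparse card_Diff_subset[OF finite_subset[OF FK finK] FK]
        by (cases b) (simp_all del: card_nsets)
      then have "?balanced_copy c"
        using k by blast
      then obtain f where f: "inj_on f (verts G)" "f ` verts G \<subseteq> {..<n}"
        "card (edges (image_graph f G) \<inter> {e. c e = True}) \<in> {?e div 2, (?e + 1) div 2}"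
        using balanced_copy_iff[OF assms(1), of n c True] by blast
      then have "?e div 2 \<le> card (edges (image_graph f G) \<inter> edges F)"
        by (auto simp: c_def)
      then show False
        using free f(1,2) half_iff[OF F(1,2)] by blast
    qed
  qed
qed

end
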